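(* Let $0\le\alpha<1$ and let $\theta(x,t)$ be a smooth solution, periodic in $x\in\mathbb{R}^d$, of the active scalar equation $\theta_t=(u\cdot\nabla)\theta-(-\Delta)^\alpha\theta$, $\theta(x,0)=\theta_0(x)$, where the velocity $u$ is determined from $\theta$. Suppose that $\omega(\xi,t)$ is continuous in $(\xi,t)$ and piecewise $C^1$ in $t$ for each fixed $\xi$, that for any fixed $t\ge0$ the function $\omega(\cdot,t)$ is a modulus of continuity, that $\partial^2_{\xi\xi}\omega(0,t)=-\infty$ for all $t\ge0$, and that $\theta_0$ obeys $\omega(\cdot,0)$. Suppose moreover that $$\partial_t\omega(\xi,t)>\Omega_\omega(\xi,t)\,\partial_\xi\omega(\xi,t)+D_{\alpha,\omega}(\xi,t)$$ for all $\xi,t>0$ such that $\omega(\xi,t)\le2\|\theta(\cdot,t)\|_{L^\infty}$, where at points at which $\partial_\xi\omega(\xi,t)$ (respectively $\partial_t\omega(\xi,t)$) does not exist, the larger (respectively smaller) value of the one-sided derivative is taken. Suppose that for some $t>0$ the solution $\theta(\cdot,t)$ does not obey $\omega(\cdot,t)$. Then there must exist $t_1>0$ and $x\ne y$ such that for all $t<t_1$, $\theta(\cdot,t)$ obeys $\omega(\cdot,t)$, while $$\theta(x,t_1)-\theta(y,t_1)=\omega(|x-y|,t_1).$$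
   Context: A modulus of continuity is a function $\omega:\mathbb{R}^+\to\mathbb{R}^+$ with $\omega(0)=0$ that is continuous, increasing, concave, and piecewise $C^1$ on $(0,\infty)$ (its derivative is continuous apart from perhaps a finite number of points where one-sided derivatives exist but may not be equal). A function $f$ obeys (has) $\omega$ if $|f(x)-f(y)|<\omega(|x-y|)$ for all $x\ne y$. $\Omega_\omega$ denotes a modulus of continuity, depending on $\omega$ and on the active scalar considered, such that if $\theta$ has modulus of continuity $\omega$, then $u$ has modulus of continuity $\Omega_\omega$ (for example $\Omega_\omega=\omega$ if $u=\theta$); $\Omega_\omega(\xi,t)$ is this function for $\omega(\cdot,t)$. The dissipation expression is $$D_{\alpha,\omega}(\xi)=c_\alpha\left(\int_0^{\xi/2}\frac{\omega(\xi+2\eta)+\omega(\xi-2\eta)-2\omega(\xi)}{\eta^{1+2\alpha}}\,d\eta+\int_{\xi/2}^\infty\frac{\omega(\xi+2\eta)-\omega(2\eta-\xi)-2\omega(\xi)}{\eta^{1+2\alpha}}\,d\eta\right),$$ and $D_{\alpha,\omega}(\xi,t)$ is this expression for $\omega(\cdot,t)$. Here $c_\alpha\in(0,1)$ is a fixed constant for which the one-dimensional fractional heat kernel $\Phi_t$ (the kernel of $e^{-(-\Delta)^\alpha t}$) satisfies $c_\alpha\min(t^{-1/(2\alpha)},t|x|^{-1-2\alpha})\le\Phi_t(x)\le c_\alpha^{-1}\min(t^{-1/(2\alpha)},t|x|^{-1-2\alpha})$. When $\alpha=0$ the dissipative term is absent from the equation, and correspondingly $D_{\alpha,\omega}$ is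 absent. *)

theory Defs
  imports "HOL-Analysis.Analysis" "HOL-Probability.Essential_Supremum"
begin

text \<open>Time is the first argument throughout: \<open>\<theta> t x\<close> and \<open>\<omega> t \<xi>\<close> stand for
  \<open>\<theta>(x,t)\<close> and \<open>\<omega>(\<xi>,t)\<close>, so that \<open>\<theta> t\<close> and \<open>\<omega> t\<close> are the sections at time \<open>t\<close>.\<close>


section \<open>Moduli of continuity\<close>

definition piecewise_C1_on :: "real set \<Rightarrow> (real \<Rightarrow> real) \<Rightarrow> bool" where
  "piecewise_C1_on I f \<longleftrightarrow>
     (\<exists>S. finite S \<and> S \<subseteq> I \<and> f C1_differentiable_on (I - S) \<and>
          (\<forall>x\<in>S. (\<exists>l. (f has_real_derivative l) (at_left x)) \<and>
                 (\<exists>r. (f has_real_derivative r) (at_right x))))"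

text \<open>Only the values on \<open>[0,\<infinity>)\<close> matter. \<open>Increasing\<close> is meant in the weak sense, so moduli
  that are constant from some point on are included.\<close>

definition modulus_of_continuity :: "(real \<Rightarrow> real) \<Rightarrow> bool" where
  "modulus_of_continuity \<omega> \<longleftrightarrow>
     \<omega> 0 = 0 \<and> (\<forall>\<xi>\<ge>0. 0 \<le> \<omega> \<xi>) \<and> continuous_on {0..} \<omega> \<and> mono_on {0..} \<omega> \<and>
     concave_on {0..} \<omega> \<and> piecewise_C1_on {0<..} \<omega>"

definition obeys :: "('a::metric_space \<Rightarrow> 'b::metric_space) \<Rightarrow> (real \<Rightarrow> real) \<Rightarrow> bool" where
  "obeys f \<omega> \<longleftrightarrow> (\<forall>x y. x \<noteq> y \<longrightarrow> dist (f x) (f y) < \<omega> (dist x y))"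

text \<open>\<open>\<omega>''(0) = -\<infinity>\<close>, read as the one-sided derivative of \<open>\<omega>'\<close> at \<open>0\<close>. Extended reals allow for
  \<open>d = \<omega>'(0) = \<infinity>\<close>; the difference quotient of \<open>\<omega>'\<close> is then \<open>-\<infinity>\<close>.\<close>

definition second_deriv_at_0_eq_MInf :: "(real \<Rightarrow> real) \<Rightarrow> bool" where
  "second_deriv_at_0_eq_MInf \<omega> \<longleftrightarrow>
     (\<exists>d::ereal. ((\<lambda>\<xi>. ereal ((\<omega> \<xi> - \<omega> 0) / \<xi>)) \<longlongrightarrow> d) (at_right 0) \<and>
                 ((\<lambda>\<xi>. (ereal (deriv \<omega> \<xi>) - d) / ereal \<xi>) \<longlongrightarrow> -\<infinity>) (at_right 0))"

definition larger_deriv :: "(real \<Rightarrow> real) \<Rightarrow> real \<Rightarrow> real" where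
  "larger_deriv f x = max (vector_derivative f (at_left x)) (vector_derivative f (at_right x))"

definition smaller_deriv :: "(real \<Rightarrow> real) \<Rightarrow> real \<Rightarrow> real" where
  "smaller_deriv f x = min (vector_derivative f (at_left x)) (vector_derivative f (at_right x))"


section \<open>The dissipation expression\<close>

definition frac_heat_kernel :: "real \<Rightarrow> real \<Rightarrow> real \<Rightarrow> real" where
  "frac_heat_kernel \<alpha> t x =
     Re (LINT k|lborel. exp (\<i> * of_real (k * x)) * of_real (exp (- t * \<bar>k\<bar> powr (2 * \<alpha>)))) / (2 * pi)"

text \<open>The case distinction is needed because \<open>0 powr a = 0\<close>, whereas here
  \<open>\<bar>x\<bar> powr (-1 - 2 * \<alpha>)\<close> has to be \<open>\<infinity>\<close> at \<open>x = 0\<close>.\<close>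

definition heat_kernel_profile :: "real \<Rightarrow> real \<Rightarrow> real \<Rightarrow> real" where
  "heat_kernel_profile \<alpha> t x =
     (if x = 0 then t powr (-1 / (2 * \<alpha>))
      else min (t powr (-1 / (2 * \<alpha>))) (t * \<bar>x\<bar> powr (-1 - 2 * \<alpha>)))"

definition heat_kernel_constant :: "real \<Rightarrow> real \<Rightarrow> bool" where
  "heat_kernel_constant \<alpha> c \<longleftrightarrow> 0 < c \<and> c < 1 \<and>
     (\<forall>t>0. \<forall>x. c * heat_kernel_profile \<alpha> t x \<le> frac_heat_kernel \<alpha> t x \<and>
                frac_heat_kernel \<alpha> t x \<le> inverse c * heat_kernel_profile \<alpha> t x)"

definition ext_integral :: "real set \<Rightarrow> (real \<Rightarrow> real) \<Rightarrow> ereal" where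
  "ext_integral S f =
     enn2ereal (\<integral>\<^sup>+x\<in>S. ennreal (f x) \<partial>lborel) - enn2ereal (\<integral>\<^sup>+x\<in>S. ennreal (- f x) \<partial>lborel)"

text \<open>Both integrands are nonpositive by concavity, and the first integral may be \<open>-\<infinity>\<close> (for
  instance at a corner of \<open>\<omega>\<close> when \<open>2 * \<alpha> \<ge> 1\<close>); hence the extended real value. For \<open>\<alpha> = 0\<close>
  there is no dissipation.\<close>

definition dissipation :: "real \<Rightarrow> real \<Rightarrow> (real \<Rightarrow> real) \<Rightarrow> real \<Rightarrow> ereal" where
  "dissipation \<alpha> c \<omega> \<xi> =
     (if \<alpha> = 0 then 0
      else ereal c *
        (ext_integral {0<..<\<xi>/2}
           (\<lambda>\<eta>. (\<omega> (\<xi> + 2 * \<eta>) + \<omega> (\<xi> - 2 * \<eta>) - 2 * \<omega> \<xi>) / \<eta> powr (1 + 2 * \<alpha>)) +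
         ext_integral {\<xi>/2<..}
           (\<lambda>\<eta>. (\<omega> (\<xi> + 2 * \<eta>) - \<omega> (2 * \<eta> - \<xi>) - 2 * \<omega> \<xi>) / \<eta> powr (1 + 2 * \<alpha>))))"


section \<open>Smooth periodic functions and the fractional Laplacian\<close>

primrec Ck_on :: "nat \<Rightarrow> 'a::real_normed_vector set \<Rightarrow> ('a \<Rightarrow> real) \<Rightarrow> bool" where
  "Ck_on 0 S f \<longleftrightarrow> continuous_on S f"
| "Ck_on (Suc n) S f \<longleftrightarrow>
     (\<exists>f'. (\<forall>z\<in>S. (f has_derivative f' z) (at z within S)) \<and> (\<forall>v. Ck_on n S (\<lambda>z. f' z v)))"

definition smooth_on :: "'a::real_normed_vector set \<Rightarrow> ('a \<Rightarrow> real) \<Rightarrow> bool" where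
  "smooth_on S f \<longleftrightarrow> (\<forall>n. Ck_on n S f)"

text \<open>The columns of the invertible matrix \<open>P\<close> generate the period lattice.\<close>

definition periodic_wrt :: "real^'n^'n \<Rightarrow> (real^'n \<Rightarrow> 'b) \<Rightarrow> bool" where
  "periodic_wrt P f \<longleftrightarrow> (\<forall>x i. f (x + column i P) = f x)"

definition fourier_coeff :: "real^'n^'n \<Rightarrow> (real^'n \<Rightarrow> real) \<Rightarrow> real^'n \<Rightarrow> complex" where
  "fourier_coeff P f k =
     (LINT y:cbox 0 (vec 1)|lborel. of_real (f (P *v y)) * exp (- (2 * pi * \<i> * of_real (k \<bullet> y))))"

text \<open>The Fourier multiplier \<open>\<bar>\<kappa>\<bar> powr (2 * \<alpha>)\<close> on the Fourier series of a \<open>P\<close>-periodic function: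
  \<open>\<kappa>\<close> runs through the frequencies, i.e. \<open>2\<pi>\<close> times the dual lattice, parametrised by \<open>k\<close> in the
  integer lattice; \<open>\<kappa> \<bullet> (P *v y) = 2 * pi * (k \<bullet> y)\<close>.\<close>

definition frequency :: "real^'n^'n \<Rightarrow> real^'n \<Rightarrow> real^'n" where
  "frequency P k = (2 * pi) *\<^sub>R (transpose (matrix_inv P) *v k)"

definition frac_laplacian :: "real^'n^'n \<Rightarrow> real \<Rightarrow> (real^'n \<Rightarrow> real) \<Rightarrow> real^'n \<Rightarrow> real" where
  "frac_laplacian P \<alpha> f x =
     Re (\<Sum>\<^sub>\<infinity>k\<in>{k. \<forall>i. k $ i \<in> \<int>}.
           of_real (norm (frequency P k) powr (2 * \<alpha>)) * fourier_coeff P f k *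
           exp (\<i> * of_real (frequency P k \<bullet> x)))"


section \<open>The active scalar equation\<close>

text \<open>The velocity at time \<open>t\<close> is \<open>U (\<theta> t)\<close>. For \<open>\<alpha> = 0\<close> the dissipative term is absent.\<close>

definition smooth_periodic_solution ::
  "real^'n^'n \<Rightarrow> ((real^'n \<Rightarrow> real) \<Rightarrow> real^'n \<Rightarrow> real^'n) \<Rightarrow> real \<Rightarrow>
   (real^'n \<Rightarrow> real) \<Rightarrow> (real \<Rightarrow> real^'n \<Rightarrow> real) \<Rightarrow> bool" where
  "smooth_periodic_solution P U \<alpha> \<theta>\<^sub>0 \<theta> \<longleftrightarrow>
     smooth_on ({0..} \<times> UNIV) (\<lambda>(t, x). \<theta> t x) \<and>
     (\<forall>t\<ge>0. periodic_wrt P (\<theta> t)) \<and>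
     \<theta> 0 = \<theta>\<^sub>0 \<and>
     (\<forall>t>0. \<forall>x. ((\<lambda>s. \<theta> s x) has_real_derivative
         frechet_derivative (\<theta> t) (at x) (U (\<theta> t) x)
         - (if \<alpha> = 0 then 0 else frac_laplacian P \<alpha> (\<theta> t) x)) (at t))"

definition velocity_modulus ::
  "real^'n^'n \<Rightarrow> ((real^'n \<Rightarrow> real) \<Rightarrow> real^'n \<Rightarrow> real^'n) \<Rightarrow>
   (real \<Rightarrow> real) \<Rightarrow> (real \<Rightarrow> real) \<Rightarrow> bool" where
  "velocity_modulus P U \<omega> \<omega>\<^sub>u \<longleftrightarrow> modulus_of_continuity \<omega>\<^sub>u \<and>
     (\<forall>f. smooth_on UNIV f \<and> periodic_wrt P f \<and> obeys f \<omega> \<longrightarrow> obeys (U f) \<omega>\<^sub>u)"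

end

theory Submission
  imports Defs
begin

text \<open>The times at which \<open>\<theta> t\<close> fails to obey \<open>\<omega> t\<close> form a closed set, so there is a first one,
  \<open>t\<^sub>1 > 0\<close>, and by continuity \<open>\<bar>\<theta> t\<^sub>1 x - \<theta> t\<^sub>1 y\<bar> \<le> \<omega> t\<^sub>1 \<bar>x - y\<bar>\<close> with equality for some
  \<open>x \<noteq> y\<close>. For closedness take violations \<open>(x\<^sub>n, y\<^sub>n)\<close> at times \<open>t\<^sub>n \<rightarrow> t\<close>. Periodicity and monotonicity
  of \<open>\<omega>\<close> confine them to a compact set, so a subsequence converges to some \<open>(x, y)\<close>. If \<open>x \<noteq> y\<close>, this
  pair violates \<open>\<omega> t\<close>. If \<open>x = y\<close>, then, since \<open>\<omega> t \<xi> / \<xi>\<close> is nonincreasing in \<open>\<xi>\<close>, some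
  directional derivative of \<open>\<theta> t\<close> at \<open>x\<close> is at least \<open>(\<omega> t)'(0)\<close>; as \<open>\<theta> t\<close> is \<open>C\<^sup>2\<close> and
  \<open>(\<omega> t)''(0) = -\<infinity>\<close>, moving along that direction again gives a violation at time \<open>t\<close>.\<close>

section \<open>Lattice periodicity and reduction to a bounded region\<close>

lemma periodic_wrt_lattice:
  fixes P :: "real^'n^'n"
  assumes per: "periodic_wrt P f" and k: "\<And>i. k $ i \<in> \<int>"
  shows "f (x + P *v k) = f x"
proof -
  have nat: "f (x + real m *\<^sub>R column i P) = f x" for x i m
  proof (induction m)
    case (Suc m)
    have "x + real (Suc m) *\<^sub>R column i P = (x + real m *\<^sub>R column i P) + column i P"
      by (simp add: scaleR_add_left algebra_simps)
    then show ?case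
      using Suc per unfolding periodic_wrt_def by metis
  qed simp
  have int: "f (x + r *\<^sub>R column i P) = f x" if r: "r \<in> \<int>" for x i r
  proof -
    obtain z where z: "r = of_int z"
      using r by (auto elim: Ints_cases)
    show ?thesis
    proof (cases "z \<ge> 0")
      case True
      then show ?thesis using nat[of x "nat z" i] z by simp
    next
      case False
      \<comment> \<open>For a negative multiple, the natural-number case starts at the translated
        point and leads back to \<open>x\<close>.\<close>
      then show ?thesis using nat[of "x + r *\<^sub>R column i P" "nat (- z)" i] z by simp
    qed
  qed
  have "f (x + (\<Sum>i\<in>A. k $ i *\<^sub>R column i P)) = f x" if "finite A" for A
    using that
  proof (induction A)
    case (insert i A)
    have eq: "x + (\<Sum>i\<in>insert i A. k $ i *\<^sub>R column i P)
        = (x + (\<Sum>i\<in>A. k $ i *\<^sub>R column i P)) + k $ i *\<^sub>R column i P"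
      using insert by (simp add: algebra_simps)
    show ?case
      unfolding eq int[OF k] by (rule insert.IH)
  qed simp
  from this[of UNIV] show ?thesis
    by (simp add: matrix_mult_sum scalar_mult_eq_scaleR)
qed

text \<open>In coordinates with respect to the columns of \<open>P\<close>, subtracting the integer
  parts leaves coordinates of absolute value at most 1, so the sum of the column norms serves as
  \<open>R\<close>, uniformly in \<open>x\<close>.\<close>

lemma lattice_translate_bounded:
  fixes P :: "real^'n^'n"
  assumes "invertible P"
  shows "\<exists>R. \<forall>x. \<exists>k. (\<forall>i. k $ i \<in> \<int>) \<and> norm (x + P *v k) \<le> R"
proof (rule exI, rule allI)
  fix x :: "real^'n"
  obtain Q where Q: "P ** Q = mat 1"
    using assms unfolding invertible_def by blast
  define y where "y = Q *v x"
  define k :: "real^'n" where "k = (\<chi> i. - of_int \<lfloor>y $ i\<rfloor>)"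
  have "P *v y = x"
    by (simp add: y_def matrix_vector_mul_assoc Q)
  then have eq: "x + P *v k = P *v (y + k)"
    by (simp add: matrix_vector_right_distrib)
  have "\<bar>(y + k) $ i\<bar> \<le> 1" for i
    using floor_correct[of "y $ i"] by (simp add: k_def abs_le_iff) linarith
  then have "norm (\<Sum>i\<in>UNIV. (y + k) $ i *\<^sub>R column i P) \<le> (\<Sum>i\<in>UNIV. norm (column i P))"
    by (intro sum_norm_le) (simp add: mult_left_le_one_le)
  then have "norm (x + P *v k) \<le> (\<Sum>i\<in>UNIV. norm (column i P))"
    unfolding eq by (simp add: matrix_mult_sum scalar_mult_eq_scaleR)
  moreover have "\<forall>i. k $ i \<in> \<int>"
    by (simp add: k_def)
  ultimately show "\<exists>k. (\<forall>i. k $ i \<in> \<int>) \<and> norm (x + P *v k) \<le> (\<Sum>i\<in>UNIV. norm (column i P))"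
    by blast
qed

section \<open>Moduli of continuity near the origin\<close>

text \<open>The point \<xi> is a convex combination of 0 and \<zeta>, and \<open>w 0 = 0\<close>, so
  concavity makes the slopes of chords from the origin nonincreasing.\<close>

lemma modulus_chord:
  assumes "modulus_of_continuity w" and "0 < \<xi>" "\<xi> \<le> \<zeta>"
  shows "w \<zeta> / \<zeta> \<le> w \<xi> / \<xi>"
proof -
  have "concave_on {0..} w" "w 0 = 0"
    using assms by (auto simp: modulus_of_continuity_def)
  then have "w ((1 - \<xi>/\<zeta>) *\<^sub>R 0 + (\<xi>/\<zeta>) *\<^sub>R \<zeta>) \<ge> (1 - \<xi>/\<zeta>) * w 0 + (\<xi>/\<zeta>) * w \<zeta>"
    using assms by (intro concave_onD) auto
  then show ?thesis
    using assms \<open>w 0 = 0\<close> by (simp add: field_simps)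
qed

text \<open>The finitely many exceptional points stay away from 0 on the right. Hence the
  \<open>deriv\<close> inside \<open>second_deriv_at_0_eq_MInf\<close> is a genuine derivative near
  0 and not an arbitrary default value.\<close>

lemma modulus_differentiable_near_0:
  assumes "modulus_of_continuity w"
  shows "\<forall>\<^sub>F s in at_right 0. (w has_real_derivative deriv w s) (at s)"
proof -
  obtain S D where S: "finite S" "\<And>x. x \<in> {0<..} - S \<Longrightarrow> (w has_vector_derivative D x) (at x)"
    using assms unfolding modulus_of_continuity_def piecewise_C1_on_def C1_differentiable_on_def
    by blast
  have "\<forall>\<^sub>F s in at_right 0. s \<notin> S"
    unfolding eventually_at_filter
    using eventually_nhds_in_open[of "- (S - {0})" 0] S(1)
    by (auto simp: open_Compl finite_imp_closed simp del: Compl_Diff_eq elim!: eventually_mono)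
  moreover have "\<forall>\<^sub>F s in at_right 0. (0::real) < s"
    by (simp add: eventually_at_right_less)
  ultimately show ?thesis
  proof eventually_elim
    case (elim s)
    then have "(w has_real_derivative D s) (at s)"
      using S(2) by (simp add: has_real_derivative_iff_has_vector_derivative)
    then show ?case
      using DERIV_imp_deriv by metis
  qed
qed

text \<open>If \<open>w\<close> vanished at \<xi>, monotonicity would make it vanish on all of
  [0, \<xi>], and its second derivative at 0 would be 0 instead of minus infinity.\<close>

lemma modulus_pos:
  assumes w: "modulus_of_continuity w" "second_deriv_at_0_eq_MInf w" and "\<xi> > 0"
  shows "w \<xi> > 0"
proof (rule ccontr)
  assume "\<not> w \<xi> > 0"
  then have zero: "w s = 0" if "0 \<le> s" "s \<le> \<xi>" for s
    using w(1) that mono_onD[of "{0..}" w s \<xi>]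
    by (force simp: modulus_of_continuity_def intro: antisym)
  have near: "\<forall>\<^sub>F s in at_right 0. 0 < s \<and> s < \<xi>"
    using \<open>\<xi> > 0\<close> by (auto simp: eventually_at_right_field)
  obtain d where d: "((\<lambda>\<xi>. ereal ((w \<xi> - w 0) / \<xi>)) \<longlongrightarrow> d) (at_right 0)"
    and lim: "((\<lambda>\<xi>. (ereal (deriv w \<xi>) - d) / ereal \<xi>) \<longlongrightarrow> -\<infinity>) (at_right 0)"
    using w(2) unfolding second_deriv_at_0_eq_MInf_def by blast
  have "((\<lambda>\<xi>. ereal ((w \<xi> - w 0) / \<xi>)) \<longlongrightarrow> 0) (at_right 0)"
    by (rule tendsto_eventually, rule eventually_mono[OF near]) (use zero \<open>\<xi> > 0\<close> in simp)
  then have "d = 0"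
    using d tendsto_unique trivial_limit_at_right_real by blast
  have "((\<lambda>\<xi>. (ereal (deriv w \<xi>) - d) / ereal \<xi>) \<longlongrightarrow> 0) (at_right 0)"
  proof (rule tendsto_eventually, rule eventually_mono[OF near])
    fix s assume s: "0 < s \<and> s < \<xi>"
    have "(w has_real_derivative 0) (at s)"
      by (rule DERIV_cong_ev[THEN iffD2, OF refl _ refl, of _ "\<lambda>_. 0"])
        (use s zero eventually_nhds_in_open[of "{0<..<\<xi>}" s] in \<open>auto elim!: eventually_mono\<close>)
    then have "deriv w s = 0"
      by (rule DERIV_imp_deriv)
    then show "(ereal (deriv w s) - d) / ereal s = 0"
      using \<open>d = 0\<close> by simp
  qed
  then show False
    using lim tendsto_unique trivial_limit_at_right_real by fastforce
qed

text \<open>Here \<open>h\<close> stands for the solution along a ray. If \<open>h' 0\<close>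
  dominated all chord slopes of \<open>w\<close>, it would dominate the slope of \<open>w\<close> at
  0. Since \<open>h'\<close> changes at the finite rate \<open>b\<close> while the derivative of
  \<open>w\<close> falls infinitely fast, \<open>h\<close> would then outgrow \<open>w\<close>
  immediately, against \<open>less\<close>.\<close>

lemma slope_less_modulus:
  assumes w: "modulus_of_continuity w" "second_deriv_at_0_eq_MInf w"
    and h: "\<And>s. (h has_real_derivative h' s) (at s)"
    and h': "(h' has_real_derivative b) (at 0)"
    and less: "\<And>s. s > 0 \<Longrightarrow> h s - h 0 < w s"
  shows "\<exists>\<xi>>0. h' 0 < w \<xi> / \<xi>"
proof (rule ccontr)
  assume "\<not> ?thesis"
  then have slope: "w \<xi> / \<xi> \<le> h' 0" if "\<xi> > 0" for \<xi>
    using that by (meson not_less)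
  have w0: "w 0 = 0" and cont: "continuous_on {0..} w" and nonneg: "\<And>\<xi>. \<xi> \<ge> 0 \<Longrightarrow> 0 \<le> w \<xi>"
    using w(1) by (auto simp: modulus_of_continuity_def)
  obtain d where d: "((\<lambda>\<xi>. ereal ((w \<xi> - w 0) / \<xi>)) \<longlongrightarrow> d) (at_right 0)"
    and lim: "((\<lambda>\<xi>. (ereal (deriv w \<xi>) - d) / ereal \<xi>) \<longlongrightarrow> -\<infinity>) (at_right 0)"
    using w(2) unfolding second_deriv_at_0_eq_MInf_def by blast
  have pos: "\<forall>\<^sub>F s in at_right 0. (0::real) < s"
    by (simp add: eventually_at_right_less)
  \<comment> \<open>Together with \<open>0 \<le> d\<close>, this rules out an infinite slope of
    \<open>w\<close> at the origin.\<close>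
  have "d \<le> ereal (h' 0)"
    by (rule tendsto_upperbound[OF d]) (auto intro!: eventually_mono[OF pos] slope simp: w0)
  moreover have "0 \<le> d"
    by (rule tendsto_lowerbound[OF d])
      (auto intro!: eventually_mono[OF pos] divide_nonneg_pos nonneg simp: w0)
  ultimately obtain r where r: "d = ereal r" "r \<le> h' 0"
    by (cases d) auto
  \<comment> \<open>Any \<open>K\<close> with \<open>- K < b\<close> would do: the line of slope
    \<open>- K\<close> separates the decay of the derivative of \<open>w\<close> from that of
    \<open>h'\<close>.\<close>
  define K where "K = \<bar>b\<bar> + 1"
  have "\<forall>\<^sub>F s in at_right 0. (ereal (deriv w s) - d) / ereal s < ereal (- K)"
    using lim by (rule order_tendstoD) simp
  moreover have "((\<lambda>s. (h' s - h' 0) / (s - 0)) \<longlongrightarrow> b) (at_right 0)"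
    using h' unfolding has_field_derivative_iff
    by (rule filterlim_mono) (auto simp: at_le)
  then have "\<forall>\<^sub>F s in at_right 0. - K < (h' s - h' 0) / (s - 0)"
    by (rule order_tendstoD) (simp add: K_def)
  moreover note modulus_differentiable_near_0[OF w(1)] pos
  ultimately have "\<forall>\<^sub>F s in at_right 0. (w has_real_derivative deriv w s) (at s) \<and> deriv w s < h' s"
  proof eventually_elim
    case (elim s)
    then have "(deriv w s - r) / s < - K"
      by (simp add: r)
    \<comment> \<open>The chain is
      \<open>deriv w s < r - K * s \<le> h' 0 - K * s < h' s\<close>.\<close>
    with elim show ?case
      using r(2) by (simp add: field_simps)
  qed
  then obtain e where e: "e > 0"
    "\<And>s. 0 < s \<Longrightarrow> s < e \<Longrightarrow> (w has_real_derivative deriv w s) (at s) \<and> deriv w s < h' s"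
    by (auto simp: eventually_at_right_field)
  \<comment> \<open>The difference \<open>h - w\<close> has positive derivative on (0, e). Stopping
    at \<open>e/2\<close> keeps the right endpoint inside the range where this is known.\<close>
  have "h 0 - w 0 < h (e/2) - w (e/2)"
  proof (rule DERIV_pos_imp_increasing_open[of 0 "e/2" "\<lambda>s. h s - w s"])
    show "\<exists>y. ((\<lambda>s. h s - w s) has_real_derivative y) (at s) \<and> 0 < y" if "0 < s" "s < e/2" for s
      using e(2)[of s] that h[of s] by (intro exI[of _ "h' s - deriv w s"]) (auto intro: DERIV_diff)
    show "continuous_on {0..e/2} (\<lambda>s. h s - w s)"
      by (intro continuous_on_diff continuous_on_subset[OF cont])
        (auto intro!: DERIV_continuous_on has_field_derivative_at_within[OF h])
  qed (use e in simp)
  then show False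
    using less[of "e/2"] e(1) w0 by simp
qed

section \<open>Closedness of the set of violation times\<close>

lemma not_obeys_closed:
  fixes P :: "real^'n^'n" and \<theta> :: "real \<Rightarrow> real^'n \<Rightarrow> real"
  assumes P: "invertible P"
    and smooth: "Ck_on 2 ({0..} \<times> UNIV) (\<lambda>(t, x). \<theta> t x)"
    and per: "\<And>t. t \<ge> 0 \<Longrightarrow> periodic_wrt P (\<theta> t)"
    and cont: "continuous_on ({0..} \<times> {0..}) (\<lambda>(\<xi>, t). \<omega> t \<xi>)"
    and modulus: "\<And>t. t \<ge> 0 \<Longrightarrow> modulus_of_continuity (\<omega> t)"
    and deriv2: "\<And>t. t \<ge> 0 \<Longrightarrow> second_deriv_at_0_eq_MInf (\<omega> t)"
  shows "closed {t. 0 \<le> t \<and> \<not> obeys (\<theta> t) (\<omega> t)}"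
proof -
  let ?S = "{0..} \<times> (UNIV :: (real^'n) set)"
  \<comment> \<open>This is the full space-time derivative; its values in directions
    \<open>(0, v)\<close> are the spatial derivatives of \<theta>. Of the two orders of smoothness,
    the first yields continuity of \<theta> and the second both continuity of \<open>f'\<close> in
    its base point and the second derivative along a ray.\<close>
  obtain f' where f': "\<And>z. z \<in> ?S \<Longrightarrow> ((\<lambda>(t, x). \<theta> t x) has_derivative f' z) (at z within ?S)"
    and Ck1: "\<And>v. Ck_on 1 ?S (\<lambda>z. f' z v)"
    using smooth by (auto simp: numeral_2_eq_2)
  have \<theta>_cont: "continuous_on ?S (\<lambda>(t, x). \<theta> t x)"
    using f' has_derivative_continuous_on by blast
  have f'_diff: "\<exists>g'. \<forall>z\<in>?S. ((\<lambda>z. f' z v) has_derivative g' z) (at z within ?S)" for v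
    using Ck1[of v] by auto
  have f'_cont: "continuous_on ?S (\<lambda>z. f' z v)" for v
    using f'_diff[of v] has_derivative_continuous_on by blast
  have f'_lin: "linear (f' z)" if "z \<in> ?S" for z
    using f'[OF that] has_derivative_linear by blast
  \<comment> \<open>A line at fixed time lies entirely in \<open>?S\<close>, even at time 0, so the
    derivative relative to \<open>?S\<close> becomes a two-sided derivative along the line.\<close>
  have slice: "((\<lambda>s. F (t, x + s *\<^sub>R v)) has_real_derivative G (0, v)) (at s)"
    if "t \<ge> 0" "(F has_derivative G) (at (t, x + s *\<^sub>R v) within ?S)"
    for F :: "real \<times> (real^'n) \<Rightarrow> real" and G t x v s
  proof -
    have "((\<lambda>s. (t, x + s *\<^sub>R v)) has_derivative (\<lambda>r. (0, r *\<^sub>R v))) (at s)"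
      by (auto intro!: derivative_eq_intros)
    then have "((\<lambda>s. F (t, x + s *\<^sub>R v)) has_derivative (\<lambda>r. G (0, r *\<^sub>R v))) (at s)"
      by (rule has_derivative_in_compose, intro has_derivative_subset[OF that(2)])
        (use that(1) in auto)
    moreover have "(\<lambda>r. G (0, r *\<^sub>R v)) = (*) (G (0, v))"
    proof
      fix r
      have "G (r *\<^sub>R (0, v)) = r *\<^sub>R G (0, v)"
        using linear_scale[OF has_derivative_linear[OF that(2)]] .
      then show "G (0, r *\<^sub>R v) = G (0, v) * r"
        by simp
    qed
    ultimately show ?thesis
      by (simp add: has_field_derivative_def)
  qed
  have \<theta>_slice: "((\<lambda>s. \<theta> t (x + s *\<^sub>R v)) has_real_derivative f' (t, x + s *\<^sub>R v) (0, v)) (at s)"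
    if "t \<ge> 0" for t x v s
    using slice[OF that f'] that by simp
  obtain R where R: "\<And>x. \<exists>k. (\<forall>i. k $ i \<in> \<int>) \<and> norm (x + P *v k) \<le> R"
    using lattice_translate_bounded[OF P] by blast
  \<comment> \<open>A common lattice translation brings \<open>x\<close> into the ball of radius
    \<open>R\<close>. The bound \<open>3 * R\<close> for \<open>y\<close> covers pairs at distance
    at most \<open>2 * R\<close>; more distant pairs are brought together below.\<close>
  have violation: "\<exists>x y. x \<noteq> y \<and> norm x \<le> R \<and> norm y \<le> 3 * R \<and>
      \<omega> t (dist x y) \<le> \<theta> t x - \<theta> t y"
    if t: "t \<ge> 0" and bad: "\<not> obeys (\<theta> t) (\<omega> t)" for t
  proof -
    obtain x y where xy: "x \<noteq> y" "\<omega> t (dist x y) \<le> \<theta> t x - \<theta> t y"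
    proof -
      obtain a b where ab: "a \<noteq> b" "\<omega> t (dist a b) \<le> \<bar>\<theta> t a - \<theta> t b\<bar>"
        using bad unfolding obeys_def dist_real_def by (meson not_less)
      show thesis
        using that[of a b] that[of b a] ab by (cases "\<theta> t a \<ge> \<theta> t b") (auto simp: dist_commute)
    qed
    obtain k where k: "\<And>i. k $ i \<in> \<int>" "norm (x + P *v k) \<le> R"
      using R by blast
    define x' y' where "x' = x + P *v k" and "y' = y + P *v k"
    have xy': "x' \<noteq> y'" "dist x' y' = dist x y" "\<theta> t x' = \<theta> t x" "\<theta> t y' = \<theta> t y" "norm x' \<le> R"
      using xy k periodic_wrt_lattice[OF per[OF t]] by (auto simp: x'_def y'_def)
    show ?thesis
    proof (cases "dist x' y' \<le> 2 * R")
      case True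
      have "norm y' \<le> norm x' + dist x' y'"
        by (metis dist_commute dist_norm norm_triangle_sub)
      then show ?thesis
        using True xy xy' by (intro exI[of _ x'] exI[of _ y']) auto
    next
      case False
      \<comment> \<open>Translating the second point alone preserves the values of \<theta> and
        reduces the distance to at most \<open>2 * R\<close>; since \<omega> is monotone, the
        violation persists.\<close>
      obtain l where l: "\<And>i. l $ i \<in> \<int>" "norm (y' + P *v l) \<le> R"
        using R by blast
      define y'' where "y'' = y' + P *v l"
      have y'': "norm y'' \<le> R" "\<theta> t y'' = \<theta> t y"
        using l xy' periodic_wrt_lattice[OF per[OF t]] by (auto simp: y''_def)
      have "dist x' y'' \<le> norm x' + norm y''"
        by (simp add: dist_norm norm_triangle_ineq4)
      then have "dist x' y'' \<le> dist x y"
        using False xy' y'' by linarith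
      then have "\<omega> t (dist x' y'') \<le> \<omega> t (dist x y)"
        using modulus[OF t] by (auto simp: modulus_of_continuity_def intro: mono_onD)
      \<comment> \<open>If the points coincided, the values of \<theta> would agree at the original
        pair, and the violation would force \<omega> to be nonpositive at a positive
        distance.\<close>
      moreover have "x' \<noteq> y''"
        using xy xy' y'' modulus_pos[OF modulus[OF t] deriv2[OF t], of "dist x y"] by auto
      moreover have "R \<ge> 0"
        using xy'(5) norm_ge_zero order_trans by blast
      ultimately show ?thesis
        using xy xy' y'' by (intro exI[of _ x'] exI[of _ y'']) auto
    qed
  qed
  show ?thesis
    unfolding closed_sequential_limits
  proof (intro allI impI, elim conjE)
    fix T t assume T: "\<forall>n. T n \<in> {t. 0 \<le> t \<and> \<not> obeys (\<theta> t) (\<omega> t)}" and Tt: "T \<longlonglongrightarrow> t"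
    have T0: "T n \<ge> 0" for n
      using T by blast
    have t0: "t \<ge> 0"
      using Tt T0 LIMSEQ_le_const by blast
    have "\<forall>n. \<exists>x y. x \<noteq> y \<and> norm x \<le> R \<and> norm y \<le> 3 * R \<and>
        \<omega> (T n) (dist x y) \<le> \<theta> (T n) x - \<theta> (T n) y"
      using T violation by blast
    then obtain X Y where XY: "\<And>n. X n \<noteq> Y n" "\<And>n. norm (X n) \<le> R" "\<And>n. norm (Y n) \<le> 3 * R"
      "\<And>n. \<omega> (T n) (dist (X n) (Y n)) \<le> \<theta> (T n) (X n) - \<theta> (T n) (Y n)"
      by metis
    \<comment> \<open>The third factor records the unit direction of the pair, so that a limiting
      direction survives when both points converge to the same limit.\<close>
    let ?K = "cball (0 :: real^'n) R \<times> cball (0 :: real^'n) (3 * R) \<times> sphere (0 :: real^'n) 1"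
    have "compact ?K"
      by (intro compact_Times) auto
    moreover have "\<forall>n. (X n, Y n, sgn (X n - Y n)) \<in> ?K"
      using XY by (auto simp: norm_sgn)
    ultimately obtain l q where "l \<in> ?K" and q: "strict_mono q"
      and lim: "((\<lambda>n. (X n, Y n, sgn (X n - Y n))) \<circ> q) \<longlonglongrightarrow> l"
      unfolding compact_def by meson
    obtain x y e where l: "l = (x, y, e)" and e: "norm e = 1"
      using \<open>l \<in> ?K\<close> by (cases l) auto
    have X: "(\<lambda>n. X (q n)) \<longlonglongrightarrow> x"
      using tendsto_fst[OF lim] by (simp add: l o_def)
    have Y: "(\<lambda>n. Y (q n)) \<longlonglongrightarrow> y"
      using tendsto_fst[OF tendsto_snd[OF lim]] by (simp add: l o_def)
    have E: "(\<lambda>n. sgn (X (q n) - Y (q n))) \<longlonglongrightarrow> e"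
      using tendsto_snd[OF tendsto_snd[OF lim]] by (simp add: l o_def)
    have Tq: "(\<lambda>n. T (q n)) \<longlonglongrightarrow> t"
      using LIMSEQ_subseq_LIMSEQ[OF Tt q] by (simp add: o_def)
    have \<omega>_lim: "(\<lambda>n. \<omega> (T (q n)) (Z n)) \<longlonglongrightarrow> \<omega> t z" if "Z \<longlonglongrightarrow> z" "z \<ge> 0" "\<And>n. Z n \<ge> 0" for Z z
      using continuous_on_tendsto_compose[OF cont tendsto_Pair[OF that(1) Tq]] that t0 T0 by auto
    have \<theta>_lim: "(\<lambda>n. \<theta> (T (q n)) (Z n)) \<longlonglongrightarrow> \<theta> t z" if "Z \<longlonglongrightarrow> z" for Z z
      using continuous_on_tendsto_compose[OF \<theta>_cont tendsto_Pair[OF Tq that]] t0 T0 by auto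
    have "\<not> obeys (\<theta> t) (\<omega> t)"
    proof (cases "x = y")
      case False
      have "(\<lambda>n. \<omega> (T (q n)) (dist (X (q n)) (Y (q n)))) \<longlonglongrightarrow> \<omega> t (dist x y)"
        by (intro \<omega>_lim tendsto_dist X Y) auto
      moreover have "(\<lambda>n. \<theta> (T (q n)) (X (q n)) - \<theta> (T (q n)) (Y (q n))) \<longlonglongrightarrow> \<theta> t x - \<theta> t y"
        by (intro tendsto_diff \<theta>_lim X Y)
      ultimately have "\<omega> t (dist x y) \<le> \<theta> t x - \<theta> t y"
        using XY(4) by (intro LIMSEQ_le) auto
      then have "\<not> dist (\<theta> t x) (\<theta> t y) < \<omega> t (dist x y)"
        by (simp add: dist_real_def)
      with False show ?thesis
        unfolding obeys_def by blast
    next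
      case True
      define \<rho> where "\<rho> n = dist (X (q n)) (Y (q n))" for n
      have \<rho>_pos: "\<rho> n > 0" for n
        using XY(1) by (simp add: \<rho>_def)
      have \<rho>_lim: "\<rho> \<longlonglongrightarrow> 0"
        using tendsto_dist[OF X Y] True by (simp add: \<rho>_def[abs_def])
      \<comment> \<open>The mean value theorem on the segment from \<open>Y (q n)\<close> to
        \<open>X (q n)\<close> turns the increment of \<theta> into a directional derivative at an
        intermediate point.\<close>
      have "\<exists>s. 0 < s \<and> s < 1 \<and> \<theta> (T (q n)) (X (q n)) - \<theta> (T (q n)) (Y (q n))
          = f' (T (q n), Y (q n) + s *\<^sub>R (X (q n) - Y (q n))) (0, X (q n) - Y (q n))" for n
        using MVT2[of 0 1, OF _ \<theta>_slice[OF T0[of "q n"], of "Y (q n)" "X (q n) - Y (q n)"]] by auto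
      then obtain s where s: "\<And>n. 0 < s n \<and> s n < 1" "\<And>n. \<theta> (T (q n)) (X (q n)) - \<theta> (T (q n)) (Y (q n))
          = f' (T (q n), Y (q n) + s n *\<^sub>R (X (q n) - Y (q n))) (0, X (q n) - Y (q n))"
        by metis
      define Z where "Z n = (T (q n), Y (q n) + s n *\<^sub>R (X (q n) - Y (q n)))" for n
      have ZS: "Z n \<in> ?S" for n
        using T0 by (simp add: Z_def)
      have "(\<lambda>n. s n *\<^sub>R (X (q n) - Y (q n))) \<longlonglongrightarrow> 0"
      proof (rule Lim_null_comparison[OF always_eventually \<rho>_lim], rule allI)
        show "norm (s n *\<^sub>R (X (q n) - Y (q n))) \<le> \<rho> n" for n
          using s(1)[of n] by (simp add: \<rho>_def dist_norm mult_left_le_one_le)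
      qed
      from tendsto_Pair[OF Tq tendsto_add[OF Y this]] have Z_lim: "Z \<longlonglongrightarrow> (t, x)"
        using True by (simp add: Z_def[abs_def])
      \<comment> \<open>Continuity of \<open>f'\<close> is available only for each fixed direction,
        whereas the direction varies with \<open>n\<close>. Expansion in a basis separates the two
        dependences.\<close>
      have expand: "f' z (0, v) = (\<Sum>b\<in>Basis. (v \<bullet> b) * f' z (0, b))" if "z \<in> ?S" for z v
      proof -
        have "linear (\<lambda>v :: real^'n. (0 :: real, v))"
          by (intro linearI) auto
        then have lin: "linear (\<lambda>v. f' z (0, v))"
          using linear_compose[OF _ f'_lin[OF that]] by (simp add: o_def)
        have "f' z (0, v) = f' z (0, \<Sum>b\<in>Basis. (v \<bullet> b) *\<^sub>R b)"
          by (simp add: euclidean_representation)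
        also have "\<dots> = (\<Sum>b\<in>Basis. (v \<bullet> b) * f' z (0, b))"
          by (simp only: linear_sum[OF lin] linear_scale[OF lin] real_scaleR_def)
        finally show ?thesis .
      qed
      have "(\<lambda>n. \<Sum>b\<in>Basis. (sgn (X (q n) - Y (q n)) \<bullet> b) * f' (Z n) (0, b))
          \<longlonglongrightarrow> (\<Sum>b\<in>Basis. (e \<bullet> b) * f' (t, x) (0, b))"
        by (intro tendsto_sum tendsto_mult tendsto_inner E tendsto_const
            continuous_on_tendsto_compose[OF f'_cont Z_lim]) (use t0 ZS in auto)
      then have D_lim: "(\<lambda>n. f' (Z n) (0, sgn (X (q n) - Y (q n)))) \<longlonglongrightarrow> f' (t, x) (0, e)"
        using ZS t0 by (simp add: expand)
      have D_ge: "\<omega> (T (q n)) (\<rho> n) / \<rho> n \<le> f' (Z n) (0, sgn (X (q n) - Y (q n)))" for n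
      proof -
        have "(0, sgn (X (q n) - Y (q n))) = (1 / \<rho> n) *\<^sub>R (0 :: real, X (q n) - Y (q n))"
          by (simp add: sgn_div_norm \<rho>_def dist_norm divide_inverse)
        then have "f' (Z n) (0, sgn (X (q n) - Y (q n)))
            = (\<theta> (T (q n)) (X (q n)) - \<theta> (T (q n)) (Y (q n))) / \<rho> n"
          by (simp only: linear_scale[OF f'_lin[OF ZS]] s(2) Z_def[symmetric]) simp
        then show ?thesis
          using XY(4)[of "q n"] \<rho>_pos[of n] by (simp add: divide_right_mono \<rho>_def)
      qed
      \<comment> \<open>Once \<open>\<rho> n < \<xi>\<close>, \<open>modulus_chord\<close> replaces
        the shrinking chord by the one at the fixed \<xi>, where continuity of \<omega> in time
        allows passing to the limit.\<close>
      have slope: "\<omega> t \<xi> / \<xi> \<le> f' (t, x) (0, e)" if "\<xi> > 0" for \<xi>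
      proof (rule tendsto_le[OF _ D_lim])
        show "(\<lambda>n. \<omega> (T (q n)) \<xi> / \<xi>) \<longlonglongrightarrow> \<omega> t \<xi> / \<xi>"
          using that by (intro tendsto_divide \<omega>_lim tendsto_const) auto
        have "\<forall>\<^sub>F n in sequentially. \<rho> n < \<xi>"
          using \<rho>_lim that by (rule order_tendstoD)
        then show "\<forall>\<^sub>F n in sequentially. \<omega> (T (q n)) \<xi> / \<xi> \<le> f' (Z n) (0, sgn (X (q n) - Y (q n)))"
        proof eventually_elim
          case (elim n)
          then show ?case
            using modulus_chord[OF modulus[OF T0[of "q n"]] \<rho>_pos[of n], of \<xi>] D_ge[of n] by linarith
        qed
      qed simp
      obtain g' where g': "\<And>z. z \<in> ?S \<Longrightarrow> ((\<lambda>z. f' z (0, e)) has_derivative g' z) (at z within ?S)"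
        using f'_diff by blast
      show ?thesis
      proof
        assume ob: "obeys (\<theta> t) (\<omega> t)"
        \<comment> \<open>The contradiction hypothesis supplies the bound along the ray from
          \<open>x\<close> in the unit direction \<open>e\<close>. The term
          \<open>x + 0 *\<^sub>R e\<close> is left unsimplified to match \<open>h 0\<close> and
          \<open>h' 0\<close> of the lemma applied.\<close>
        have "\<exists>\<xi>>0. f' (t, x + 0 *\<^sub>R e) (0, e) < \<omega> t \<xi> / \<xi>"
        proof (rule slope_less_modulus[OF modulus[OF t0] deriv2[OF t0] \<theta>_slice[OF t0]])
          show "((\<lambda>s. f' (t, x + s *\<^sub>R e) (0, e)) has_real_derivative g' (t, x + 0 *\<^sub>R e) (0, e)) (at 0)"
            by (rule slice[OF t0 g']) (use t0 in simp)
          fix s :: real assume "s > 0"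
          moreover have "e \<noteq> 0"
            using e by auto
          ultimately have "dist (\<theta> t (x + s *\<^sub>R e)) (\<theta> t x) < \<omega> t (dist (x + s *\<^sub>R e) x)"
            using ob unfolding obeys_def by auto
          then show "\<theta> t (x + s *\<^sub>R e) - \<theta> t (x + 0 *\<^sub>R e) < \<omega> t s"
            using e \<open>s > 0\<close> by (simp add: dist_real_def dist_norm)
        qed
        then show False
          using slope by force
      qed
    qed
    with t0 show "t \<in> {t. 0 \<le> t \<and> \<not> obeys (\<theta> t) (\<omega> t)}"
      by blast
  qed
qed

section \<open>The first violation time and equality there\<close>

theorem lemma2p3:
  fixes \<alpha> c :: real
    and P :: "real^'n^'n"
    and U :: "(real^'n \<Rightarrow> real) \<Rightarrow> real^'n \<Rightarrow> real^'n"
    and \<theta>\<^sub>0 :: "real^'n \<Rightarrow> real"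
    and \<theta> :: "real \<Rightarrow> real^'n \<Rightarrow> real"
    and \<omega> :: "real \<Rightarrow> real \<Rightarrow> real"
    and \<Omega> :: "(real \<Rightarrow> real) \<Rightarrow> real \<Rightarrow> real"
  assumes "0 \<le> \<alpha>" and "\<alpha> < 1"
    and "\<alpha> > 0 \<longrightarrow> heat_kernel_constant \<alpha> c"
    and "invertible P"
    and "smooth_periodic_solution P U \<alpha> \<theta>\<^sub>0 \<theta>"
    and "continuous_on ({0..} \<times> {0..}) (\<lambda>(\<xi>, t). \<omega> t \<xi>)"
    and "\<And>\<xi>. \<xi> \<ge> 0 \<Longrightarrow> piecewise_C1_on {0<..} (\<lambda>t. \<omega> t \<xi>)"
    and "\<And>t. t \<ge> 0 \<Longrightarrow> modulus_of_continuity (\<omega> t)"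
    and "\<And>t. t \<ge> 0 \<Longrightarrow> second_deriv_at_0_eq_MInf (\<omega> t)"
    and "obeys \<theta>\<^sub>0 (\<omega> 0)"
    and "\<And>t. t \<ge> 0 \<Longrightarrow> velocity_modulus P U (\<omega> t) (\<Omega> (\<omega> t))"
    and "\<And>\<xi> t. \<xi> > 0 \<Longrightarrow> t > 0 \<Longrightarrow>
           ereal (\<omega> t \<xi>) \<le> 2 * esssup lborel (\<lambda>x. ereal \<bar>\<theta> t x\<bar>) \<Longrightarrow>
           ereal (smaller_deriv (\<lambda>s. \<omega> s \<xi>) t) >
             ereal (\<Omega> (\<omega> t) \<xi> * larger_deriv (\<omega> t) \<xi>) + dissipation \<alpha> c (\<omega> t) \<xi>"
    and "\<exists>t>0. \<not> obeys (\<theta> t) (\<omega> t)"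
  shows "\<exists>t\<^sub>1>0. \<exists>x y. x \<noteq> y \<and>
           (\<forall>t. 0 \<le> t \<and> t < t\<^sub>1 \<longrightarrow> obeys (\<theta> t) (\<omega> t)) \<and>
           \<theta> t\<^sub>1 x - \<theta> t\<^sub>1 y = \<omega> t\<^sub>1 (dist x y)"
proof -
  let ?B = "{t. 0 \<le> t \<and> \<not> obeys (\<theta> t) (\<omega> t)}"
  have smooth: "smooth_on ({0..} \<times> UNIV) (\<lambda>(t, x). \<theta> t x)"
    and per: "\<And>t. t \<ge> 0 \<Longrightarrow> periodic_wrt P (\<theta> t)" and init: "\<theta> 0 = \<theta>\<^sub>0"
    using assms(5) unfolding smooth_periodic_solution_def by blast+
  have Ck: "Ck_on n ({0..} \<times> UNIV) (\<lambda>(t, x). \<theta> t x)" for n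
    using smooth by (simp add: smooth_on_def)
  have closed: "closed ?B"
    by (rule not_obeys_closed[OF assms(4) Ck per assms(6,8,9)])
  have ne: "?B \<noteq> {}"
    using assms(13) less_imp_le by blast
  have bdd: "bdd_below ?B"
    by (rule bdd_belowI[of _ 0]) simp
  define t\<^sub>1 where "t\<^sub>1 = Inf ?B"
  have "t\<^sub>1 \<in> ?B"
    unfolding t\<^sub>1_def by (rule closed_contains_Inf[OF ne bdd closed])
  then have "t\<^sub>1 \<ge> 0" and bad: "\<not> obeys (\<theta> t\<^sub>1) (\<omega> t\<^sub>1)"
    by auto
  then have "t\<^sub>1 > 0"
    using assms(10) init by (cases "t\<^sub>1 = 0") auto
  have before: "obeys (\<theta> t) (\<omega> t)" if "0 \<le> t" "t < t\<^sub>1" for t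
    using that cInf_lower[OF _ bdd, of t] unfolding t\<^sub>1_def by fastforce
  obtain a b where ab: "a \<noteq> b" "\<omega> t\<^sub>1 (dist a b) \<le> \<bar>\<theta> t\<^sub>1 a - \<theta> t\<^sub>1 b\<bar>"
    using bad unfolding obeys_def dist_real_def by (meson not_less)
  \<comment> \<open>Since \<open>t\<^sub>1\<close> is positive, it can be approached from the left
    through times at which the modulus is obeyed.\<close>
  have nonneg: "\<forall>\<^sub>F t in at_left t\<^sub>1. 0 \<le> t" and left: "\<forall>\<^sub>F t in at_left t\<^sub>1. 0 \<le> t \<and> t < t\<^sub>1"
    using \<open>t\<^sub>1 > 0\<close> by (auto simp: eventually_at_left_field intro!: exI[of _ 0])
  have t_lim: "((\<lambda>t. t) \<longlongrightarrow> t\<^sub>1) (at_left t\<^sub>1)"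
    by (rule tendsto_ident_at)
  have \<theta>_lim: "((\<lambda>t. \<theta> t z) \<longlongrightarrow> \<theta> t\<^sub>1 z) (at_left t\<^sub>1)" for z
    using continuous_on_tendsto_compose[OF Ck[of 0, simplified] tendsto_Pair[OF t_lim tendsto_const[of z]]]
      \<open>t\<^sub>1 > 0\<close> nonneg by simp
  have \<omega>_lim: "((\<lambda>t. \<omega> t \<xi>) \<longlongrightarrow> \<omega> t\<^sub>1 \<xi>) (at_left t\<^sub>1)" if "\<xi> \<ge> 0" for \<xi>
    using continuous_on_tendsto_compose[OF assms(6) tendsto_Pair[OF tendsto_const[of \<xi>] t_lim]]
      \<open>t\<^sub>1 > 0\<close> nonneg that by simp
  \<comment> \<open>The strict inequalities at earlier times weaken to a non-strict one in the
    limit. The same pair \<open>a\<close>, \<open>b\<close> violates the strict inequality at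
    \<open>t\<^sub>1\<close>, so equality holds.\<close>
  have "\<bar>\<theta> t\<^sub>1 a - \<theta> t\<^sub>1 b\<bar> \<le> \<omega> t\<^sub>1 (dist a b)"
  proof (rule tendsto_le)
    show "((\<lambda>t. \<bar>\<theta> t a - \<theta> t b\<bar>) \<longlongrightarrow> \<bar>\<theta> t\<^sub>1 a - \<theta> t\<^sub>1 b\<bar>) (at_left t\<^sub>1)"
      by (intro tendsto_rabs tendsto_diff \<theta>_lim)
    show "((\<lambda>t. \<omega> t (dist a b)) \<longlongrightarrow> \<omega> t\<^sub>1 (dist a b)) (at_left t\<^sub>1)"
      by (rule \<omega>_lim) simp
    show "\<forall>\<^sub>F t in at_left t\<^sub>1. \<bar>\<theta> t a - \<theta> t b\<bar> \<le> \<omega> t (dist a b)"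
      using left
    proof eventually_elim
      case (elim t)
      then have "dist (\<theta> t a) (\<theta> t b) < \<omega> t (dist a b)"
        using before ab(1) unfolding obeys_def by blast
      then show ?case
        by (simp add: dist_real_def)
    qed
  qed simp
  with ab have eq: "\<bar>\<theta> t\<^sub>1 a - \<theta> t\<^sub>1 b\<bar> = \<omega> t\<^sub>1 (dist a b)"
    by linarith
  \<comment> \<open>Exchanging the two points if necessary removes the absolute value.\<close>
  have "\<exists>x y. x \<noteq> y \<and> \<theta> t\<^sub>1 x - \<theta> t\<^sub>1 y = \<omega> t\<^sub>1 (dist x y)"
  proof (cases "\<theta> t\<^sub>1 a \<ge> \<theta> t\<^sub>1 b")
    case True
    then show ?thesis
      using eq ab(1) by (intro exI[of _ a] exI[of _ b]) auto
  next
    case False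
    then show ?thesis
      using eq ab(1) by (intro exI[of _ b] exI[of _ a]) (auto simp: dist_commute)
  qed
  with \<open>t\<^sub>1 > 0\<close> before show ?thesis
    by blast
qed

end
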